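(* Let $n\geq 4$ and $0\le p\le 1$. In the $n$-dimensional bubble-sort network $B_n$ under the random node fault model in which each node is fault-free independently with probability $p$, $$P(0,2,2)=\tfrac{1}{4}(n^8-8n^7+30n^6-69n^5+104n^4-99n^3+53n^2-12n)p^{4(n-2)!}+(n^7-8n^6+29n^5-59n^4+68n^3-41n^2+10n)p^{4(n-2)!-(n-3)!}+\tfrac{1}{2}(3n^6-23n^5+67n^4-92n^3+59n^2-14n)p^{4(n-2)!-2(n-3)!}+(n^4-6n^3+11n^2-6n)p^{4(n-2)!-3(n-3)!}+\tfrac{1}{4}(n^5-10n^4+35n^3-50n^2+24n)p^{4(n-2)!-4(n-3)!}.$$
   Context: Let $N_n=\{1,\dots,n\}$. The bubble-sort network $B_n$ has as vertices the permutations of $N_n$, written as strings $u_1u_2\cdots u_n$, two permutations being adjacent iff they differ by swapping two adjacent positions $u_i,u_{i+1}$. For distinct $a_1,a_2\in N_n$, a $B_{n-2}$-subnetwork of $B_n$ is one of the following vertex sets (each inducing a copy of $B_{n-2}$ and having $(n-2)!$ vertices): $a_1a_2X^{n-2}$, the set of permutations with $u_1=a_1,u_2=a_2$ ("prefix form"); $a_1X^{n-2}a_2$, the set with $u_1=a_1,u_n=a_2$ ("middle form"); $X^{n-2}a_1a_2$, the set with $u_{n-1}=a_1,u_n=a_2$ ("suffix form"). Each form gives $n(n-1)$ subnetworks. In the random node fault model each vertex is fault-free independently with probability $p$ (faulty with probability $1-p$); a subnetwork is fault-free if all its vertices are. For nonnegative integers $i,j,k$ with $i+j+k=4$, $P(i,j,k)$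 denotes the sum, over all sets $S$ of four distinct $B_{n-2}$-subnetworks consisting of $i$ of prefix form, $j$ of middle form and $k$ of suffix form, of the probability that all four members of $S$ are fault-free, i.e. of $p^{|\bigcup_{H\in S}H|}$. (The paper calls $P(i,j,k)$ "the probability that there are four fault-free $B_{n-2}$'s, $i$ of which are of prefix form, $j$ of middle form and $k$ of suffix form".) *)

theory Defs
  imports "HOL-Probability.Probability" "HOL-Combinatorics.Multiset_Permutations"
begin

text \<open>A vertex \<open>u\<^sub>1u\<^sub>2\<dots>u\<^sub>n\<close> is the list \<open>u\<close> with \<open>u\<^sub>i = u ! (i - 1)\<close>.\<close>

definition bubble_sort_vertices :: "nat \<Rightarrow> nat list set" where
  "bubble_sort_vertices n = permutations_of_set {1..n}"

definition bubble_sort_edges :: "nat \<Rightarrow> nat list set set" where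
  "bubble_sort_edges n =
     {{u, u[i := u ! Suc i, Suc i := u ! i]} | u i. u \<in> bubble_sort_vertices n \<and> Suc i < n}"

text \<open>
  The \<open>(n - 2)\<close>-dimensional subnetworks are identified with their vertex sets; the
  random node fault model involves no edges.
\<close>

definition prefix_subnet :: "nat \<Rightarrow> nat \<Rightarrow> nat \<Rightarrow> nat list set" where
  "prefix_subnet n a b = {u \<in> bubble_sort_vertices n. u ! 0 = a \<and> u ! 1 = b}"

definition middle_subnet :: "nat \<Rightarrow> nat \<Rightarrow> nat \<Rightarrow> nat list set" where
  "middle_subnet n a b = {u \<in> bubble_sort_vertices n. u ! 0 = a \<and> u ! (n - 1) = b}"

definition suffix_subnet :: "nat \<Rightarrow> nat \<Rightarrow> nat \<Rightarrow> nat list set" where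
  "suffix_subnet n a b = {u \<in> bubble_sort_vertices n. u ! (n - 2) = a \<and> u ! (n - 1) = b}"

definition prefix_subnets :: "nat \<Rightarrow> nat list set set" where
  "prefix_subnets n = {prefix_subnet n a b | a b. a \<in> {1..n} \<and> b \<in> {1..n} \<and> a \<noteq> b}"

definition middle_subnets :: "nat \<Rightarrow> nat list set set" where
  "middle_subnets n = {middle_subnet n a b | a b. a \<in> {1..n} \<and> b \<in> {1..n} \<and> a \<noteq> b}"

definition suffix_subnets :: "nat \<Rightarrow> nat list set set" where
  "suffix_subnets n = {suffix_subnet n a b | a b. a \<in> {1..n} \<and> b \<in> {1..n} \<and> a \<noteq> b}"

text \<open>
  A fault configuration maps each vertex to \<open>True\<close> iff it is fault-free.  Its value
  outside the vertex set is the irrelevant default \<open>False\<close>.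
\<close>

definition node_fault_model :: "nat \<Rightarrow> real \<Rightarrow> (nat list \<Rightarrow> bool) pmf" where
  "node_fault_model n p = Pi_pmf (bubble_sort_vertices n) False (\<lambda>_. bernoulli_pmf p)"

definition fault_free :: "(nat list \<Rightarrow> bool) \<Rightarrow> nat list set \<Rightarrow> bool" where
  "fault_free \<omega> H \<longleftrightarrow> (\<forall>u\<in>H. \<omega> u)"

text \<open>
  For \<open>n \<ge> 4\<close> the three forms yield pairwise different vertex sets, so the form of a member
  of a family can be read off from the vertex set itself.
\<close>

definition subnet_families :: "nat \<Rightarrow> nat \<Rightarrow> nat \<Rightarrow> nat \<Rightarrow> nat list set set set" where
  "subnet_families n i j k =
     {S. S \<subseteq> prefix_subnets n \<union> middle_subnets n \<union> suffix_subnets n \<and> card S = 4 \<and>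
         card (S \<inter> prefix_subnets n) = i \<and>
         card (S \<inter> middle_subnets n) = j \<and>
         card (S \<inter> suffix_subnets n) = k}"

text \<open>
  This is a sum of probabilities over families (an expected number of fault-free families),
  not the probability of the union of the corresponding events.
\<close>

definition P_four :: "nat \<Rightarrow> real \<Rightarrow> nat \<Rightarrow> nat \<Rightarrow> nat \<Rightarrow> real" where
  "P_four n p i j k =
     (\<Sum>S\<in>subnet_families n i j k.
        measure_pmf.prob (node_fault_model n p) {\<omega>. \<forall>H\<in>S. fault_free \<omega> H})"

lemma prob_fault_free:
  assumes "0 \<le> p" "p \<le> 1" and "S \<in> subnet_families n i j k"
  shows "measure_pmf.prob (node_fault_model n p) {\<omega>. \<forall>H\<in>S. fault_free \<omega> H} = p ^ card (\<Union>S)"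
proof -
  let ?V = "bubble_sort_vertices n"
  let ?B = "\<lambda>u. if u \<in> \<Union>S then {True} else UNIV"
  have fin: "finite ?V"
    by (simp add: bubble_sort_vertices_def)
  have "S \<subseteq> Pow ?V"
    using assms(3)
    by (fastforce simp: subnet_families_def prefix_subnets_def middle_subnets_def suffix_subnets_def
        prefix_subnet_def middle_subnet_def suffix_subnet_def)
  then have sub: "\<Union>S \<subseteq> ?V" by blast
  have "measure_pmf.prob (node_fault_model n p) {\<omega>. \<forall>H\<in>S. fault_free \<omega> H}
      = measure_pmf.prob (node_fault_model n p) (Pi ?V ?B)"
    by (rule arg_cong[where f = "measure_pmf.prob _"])
      (use sub in \<open>auto simp: fault_free_def Pi_def split: if_splits\<close>)
  also have "\<dots> = (\<Prod>u\<in>?V. measure_pmf.prob (bernoulli_pmf p) (?B u))"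
    unfolding node_fault_model_def by (rule measure_Pi_pmf_Pi[OF fin])
  also have "\<dots> = (\<Prod>u\<in>?V. if u \<in> \<Union>S then p else 1)"
    using assms(1,2) by (intro prod.cong) (auto simp: measure_pmf_single)
  also have "\<dots> = (\<Prod>u\<in>?V \<inter> \<Union>S. p)"
    using fin by (simp only: prod.inter_restrict)
  also have "?V \<inter> \<Union>S = \<Union>S"
    using sub by blast
  finally show ?thesis by simp
qed

end

theory Submission
  imports Defs
begin

text \<open>
  Two distinct subnetworks of the same form are disjoint, and the middle form with \<open>u\<^sub>1 = a\<close>,
  \<open>u\<^sub>n = b\<close> meets the suffix form with \<open>u\<^sub>n\<^sub>-\<^sub>1 = e\<close>, \<open>u\<^sub>n = f\<close> iff \<open>b = f\<close> and \<open>a \<noteq> e\<close>, in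
  \<open>(n - 3)!\<close> vertices.  So the union of a family has \<open>4(n - 2)! - m(n - 3)!\<close> vertices, where
  \<open>m\<close> is the number of meeting pairs.  Fix the two middle forms \<open>x, x'\<close>.  Each of them meets
  \<open>n - 2\<close> suffix forms, and they have \<open>n - 3\<close> of these in common if their last symbols agree
  and none otherwise; these numbers determine how many pairs of suffix forms yield each \<open>m\<close>.
\<close>

section \<open>Permutations with prescribed entries\<close>

text \<open>Induction on the number of free positions. A free position can take any of the
  \<open>card A - card K\<close> symbols that \<open>f\<close> does not use on \<open>K\<close>, and
  each choice leaves the same problem with one more prescribed position.\<close>

lemma card_permutations_of_set_prescribed:
  assumes "finite A" and "K \<subseteq> {..<card A}" and "inj_on f K" and "f ` K \<subseteq> A"
  shows "card {u \<in> permutations_of_set A. \<forall>i\<in>K. u ! i = f i} = fact (card A - card K)"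
  using assms(2-4)
proof (induction "card A - card K" arbitrary: K f)
  case 0
  have "card K = card A"
    using 0 card_mono[OF _ \<open>K \<subseteq> {..<card A}\<close>] by simp
  then have K: "K = {..<card A}" using 0 by (intro card_subset_eq) auto
  have fK: "f ` K = A"
    using 0 \<open>card K = card A\<close> assms(1) by (intro card_subset_eq) (auto simp: card_image)
  \<comment> \<open>With no free position left, \<open>f\<close> maps the positions bijectively onto
    \<open>A\<close> and so spells out the only permutation.\<close>
  have "{u \<in> permutations_of_set A. \<forall>i\<in>K. u ! i = f i} = {map f [0..<card A]}" (is "?L = ?R")
  proof
    show "?L \<subseteq> ?R"
      using K by (auto intro!: nth_equalityI simp: length_finite_permutations_of_set)
    have "set (map f [0..<card A]) = A"
      using fK K by (auto simp: atLeast0LessThan)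
    moreover have "distinct (map f [0..<card A])"
      using 0 K by (auto simp: distinct_map atLeast0LessThan)
    ultimately show "?R \<subseteq> ?L"
      using K by (auto simp: permutations_of_set_def)
  qed
  then show ?case using 0 by simp
next
  case (Suc d)
  have finK: "finite K" using Suc finite_subset by blast
  have "\<not> {..<card A} \<subseteq> K"
    using Suc card_mono[OF finK, of "{..<card A}"] by auto
  then obtain i where i: "i < card A" "i \<notin> K" by auto
  let ?T = "\<lambda>a. {u \<in> permutations_of_set A. \<forall>j\<in>insert i K. u ! j = (f(i := a)) j}"
  \<comment> \<open>Split by the entry at \<open>i\<close>. Since \<open>u\<close> is distinct, this
    entry avoids the symbols already placed; different entries give disjoint classes.\<close>
  have "{u \<in> permutations_of_set A. \<forall>j\<in>K. u ! j = f j} = (\<Union>a\<in>A - f ` K. ?T a)" (is "?L = ?R")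
  proof
    show "?L \<subseteq> ?R"
    proof
      fix u assume u: "u \<in> ?L"
      then have len: "length u = card A" and dist: "distinct u" and set: "set u = A"
        by (auto simp: length_finite_permutations_of_set permutations_of_set_def)
      have "u ! i \<notin> f ` K"
      proof
        assume "u ! i \<in> f ` K"
        then obtain j where "j \<in> K" "u ! i = u ! j" using u by auto
        then show False
          using dist len i Suc.prems(1) by (metis lessThan_iff nth_eq_iff_index_eq subsetD)
      qed
      moreover have "u ! i \<in> A" using set len i by (metis nth_mem)
      ultimately show "u \<in> ?R" using u i by auto
    qed
    show "?R \<subseteq> ?L" using i by auto
  qed
  also have "card \<dots> = (\<Sum>a\<in>A - f ` K. card (?T a))"
    using assms(1) by (intro card_UN_disjoint) auto
  also have "\<dots> = (\<Sum>a\<in>A - f ` K. fact d)"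
  proof (rule sum.cong[OF refl])
    fix a assume a: "a \<in> A - f ` K"
    have "card (?T a) = fact (card A - card (insert i K))"
    proof (rule Suc.hyps(1))
      show "d = card A - card (insert i K)" using Suc.hyps(2) i finK by simp
      show "insert i K \<subseteq> {..<card A}" using Suc.prems i by auto
      show "inj_on (f(i := a)) (insert i K)"
        using Suc.prems i a by (auto simp: inj_on_def)
      show "(f(i := a)) ` insert i K \<subseteq> A" using Suc.prems a by auto
    qed
    also have "card A - card (insert i K) = d" using Suc.hyps(2) i finK by simp
    finally show "card (?T a) = fact d" .
  qed
  also have "\<dots> = Suc d * fact d"
    using Suc.prems Suc.hyps(2) finK by (simp add: card_Diff_subset card_image)
  also have "\<dots> = fact (card A - card K)"
    using Suc.hyps(2) by (metis fact_Suc of_nat_id)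
  finally show ?case .
qed

lemma card_vertices_two_entries:
  assumes "i < n" "j < n" "i \<noteq> j" "a \<in> {1..n}" "b \<in> {1..n}" "a \<noteq> b"
  shows "card {u \<in> bubble_sort_vertices n. u ! i = a \<and> u ! j = b} = fact (n - 2)"
proof -
  \<comment> \<open>The default value \<open>b\<close> of the prescribing function serves the index
    \<open>j\<close>.\<close>
  have "card {u \<in> permutations_of_set {1..n}. \<forall>l\<in>{i, j}. u ! l = ((\<lambda>_. b)(i := a)) l}
      = fact (card {1..n} - card {i, j})"
    by (rule card_permutations_of_set_prescribed) (use assms in \<open>auto simp: inj_on_def\<close>)
  moreover have "card {i, j} = 2" using assms by simp
  ultimately show ?thesis
    using assms by (simp add: bubble_sort_vertices_def)
qed

lemma card_vertices_three_entries:
  assumes "i < n" "j < n" "k < n" "distinct [i, j, k]"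
    and "a \<in> {1..n}" "b \<in> {1..n}" "c \<in> {1..n}" "distinct [a, b, c]"
  shows "card {u \<in> bubble_sort_vertices n. u ! i = a \<and> u ! j = b \<and> u ! k = c} = fact (n - 3)"
proof -
  have "card {u \<in> permutations_of_set {1..n}. \<forall>l\<in>{i, j, k}. u ! l = ((\<lambda>_. c)(i := a, j := b)) l}
      = fact (card {1..n} - card {i, j, k})"
    by (rule card_permutations_of_set_prescribed) (use assms in \<open>auto simp: inj_on_def\<close>)
  moreover have "card {i, j, k} = 3" using assms by simp
  ultimately show ?thesis
    using assms by (simp add: bubble_sort_vertices_def)
qed

text \<open>With at least four symbols, one differs from \<open>a\<close>, \<open>b\<close> and
  \<open>c\<close> and can be placed at position \<open>k\<close>. Such vertices tell the three
  forms apart.\<close>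

lemma ex_vertex_avoiding_entry:
  assumes "n \<ge> 4" "i < n" "j < n" "k < n" "distinct [i, j, k]"
    and "a \<in> {1..n}" "b \<in> {1..n}" "a \<noteq> b"
  shows "\<exists>u\<in>bubble_sort_vertices n. u ! i = a \<and> u ! j = b \<and> u ! k \<noteq> c"
proof -
  have "\<not> {1..n} \<subseteq> {a, b, c}"
  proof
    assume "{1..n} \<subseteq> {a, b, c}"
    then have "card {1..n} \<le> card {a, b, c}" by (intro card_mono) auto
    moreover have "card {a, b, c} \<le> 3" by (simp add: card_insert_if)
    ultimately show False using assms(1) by simp
  qed
  then obtain c' where c': "c' \<in> {1..n}" "c' \<notin> {a, b, c}" by blast
  have "card {u \<in> bubble_sort_vertices n. u ! i = a \<and> u ! j = b \<and> u ! k = c'} \<noteq> 0"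
    using card_vertices_three_entries[of i n j k a b c'] assms c' by simp
  then obtain u where "u \<in> bubble_sort_vertices n" "u ! i = a" "u ! j = b" "u ! k = c'"
    by (auto simp: card_eq_0_iff)
  then show ?thesis using c' by auto
qed

section \<open>Sums over two-element subsets\<close>

definition two_subsets :: "'a set \<Rightarrow> 'a set set" where
  "two_subsets D = {R. R \<subseteq> D \<and> card R = 2}"

lemma finite_two_subsets: "finite D \<Longrightarrow> finite (two_subsets D)"
  unfolding two_subsets_def by (rule finite_subset[of _ "Pow D"]) auto

lemma two_subsets_insert:
  assumes "x \<notin> D"
  shows "two_subsets (insert x D) = two_subsets D \<union> (\<lambda>y. {x, y}) ` D"
proof
  show "two_subsets (insert x D) \<subseteq> two_subsets D \<union> (\<lambda>y. {x, y}) ` D"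
    by (auto simp: two_subsets_def card_2_iff)
  show "two_subsets D \<union> (\<lambda>y. {x, y}) ` D \<subseteq> two_subsets (insert x D)"
    using assms by (auto simp: two_subsets_def card_2_iff)
qed

text \<open>Each two-element subset has two orderings. In the induction a new subset
  \<open>{x, y}\<close> appears once in the inner sum for \<open>x\<close> and once in the inner sum
  for \<open>y\<close>.\<close>

lemma sum_two_subsets:
  fixes F :: "'a set \<Rightarrow> real"
  assumes "finite D"
  shows "2 * (\<Sum>R\<in>two_subsets D. F R) = (\<Sum>y\<in>D. \<Sum>y'\<in>D - {y}. F {y, y'})"
  using assms
proof (induction D rule: finite_induct)
  case empty
  have "two_subsets ({} :: 'a set) = {}" by (auto simp: two_subsets_def)
  then show ?case by simp
next
  case (insert x D)
  have "(\<Sum>R\<in>two_subsets (insert x D). F R)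
      = (\<Sum>R\<in>two_subsets D. F R) + (\<Sum>R\<in>(\<lambda>y. {x, y}) ` D. F R)"
    unfolding two_subsets_insert[OF insert(2)]
    using insert(1,2)
    by (intro sum.union_disjoint) (auto simp: finite_two_subsets two_subsets_def)
  also have "(\<Sum>R\<in>(\<lambda>y. {x, y}) ` D. F R) = (\<Sum>y\<in>D. F {x, y})"
    using insert(2) by (subst sum.reindex) (auto simp: inj_on_def doubleton_eq_iff)
  finally have lhs: "2 * (\<Sum>R\<in>two_subsets (insert x D). F R)
      = (\<Sum>y\<in>D. \<Sum>y'\<in>D - {y}. F {y, y'}) + 2 * (\<Sum>y\<in>D. F {x, y})"
    using insert(3) by simp
  have "(\<Sum>y'\<in>insert x D - {y}. F {y, y'}) = F {x, y} + (\<Sum>y'\<in>D - {y}. F {y, y'})"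
    if "y \<in> D" for y
  proof -
    have "insert x D - {y} = insert x (D - {y})" using that insert(2) by auto
    then show ?thesis using insert(1,2) by (simp add: insert_commute)
  qed
  then have "(\<Sum>y\<in>D. \<Sum>y'\<in>insert x D - {y}. F {y, y'})
      = (\<Sum>y\<in>D. F {x, y}) + (\<Sum>y\<in>D. \<Sum>y'\<in>D - {y}. F {y, y'})"
    by (simp add: sum.distrib)
  moreover have "insert x D - {x} = D" using insert(2) by auto
  ultimately show ?case
    using lhs insert(1,2) by simp
qed

text \<open>The sum over ordered pairs of distinct elements is completed to all ordered pairs, and
  the diagonal is subtracted. The full double sum can then be evaluated one variable at a
  time.\<close>

lemma sum_two_subsets_additive:
  fixes g :: "nat \<Rightarrow> real"
  assumes "finite D"
  shows "2 * (\<Sum>R\<in>two_subsets D. g (\<Sum>y\<in>R. w y))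
    = (\<Sum>y\<in>D. \<Sum>y'\<in>D. g (w y + w y')) - (\<Sum>y\<in>D. g (2 * w y))"
proof -
  have "(\<Sum>y'\<in>D - {y}. g (\<Sum>z\<in>{y, y'}. w z))
      = (\<Sum>y'\<in>D. g (w y + w y')) - g (2 * w y)" if "y \<in> D" for y
  proof -
    have "(\<Sum>y'\<in>D - {y}. g (\<Sum>z\<in>{y, y'}. w z)) = (\<Sum>y'\<in>D - {y}. g (w y + w y'))"
      by (intro sum.cong) auto
    then show ?thesis using assms that by (simp add: sum_diff1 mult_2)
  qed
  then show ?thesis
    by (simp add: sum_two_subsets[OF assms] sum_subtractf)
qed

lemma sum_of_bool_plus_of_bool:
  fixes g :: "nat \<Rightarrow> real"
  assumes "finite D" "A \<subseteq> D" "B \<subseteq> D"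
  shows "(\<Sum>y\<in>D. g (of_bool (y \<in> A) + of_bool (y \<in> B)))
    = (real (card D) - real (card A) - real (card B) + real (card (A \<inter> B))) * g 0
      + (real (card A) + real (card B) - 2 * real (card (A \<inter> B))) * g 1
      + real (card (A \<inter> B)) * g 2"
proof -
  \<comment> \<open>The argument of \<open>g\<close> is 0, 1 or 2, so \<open>g\<close> can be
    interpolated by the indicators of \<open>A\<close>, \<open>B\<close> and
    \<open>A \<inter> B\<close>; the last coefficient is the second difference of
    \<open>g\<close>.\<close>
  have "(\<Sum>y\<in>D. g (of_bool (y \<in> A) + of_bool (y \<in> B)))
      = (\<Sum>y\<in>D. g 0 + (g 1 - g 0) * of_bool (y \<in> A) + (g 1 - g 0) * of_bool (y \<in> B)
          + (g 2 - 2 * g 1 + g 0) * of_bool (y \<in> A \<inter> B))"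
    by (intro sum.cong refl) (auto simp: numeral_2_eq_2)
  also have "\<dots> = real (card D) * g 0 + (g 1 - g 0) * real (card A) + (g 1 - g 0) * real (card B)
      + (g 2 - 2 * g 1 + g 0) * real (card (A \<inter> B))"
  proof -
    have "(\<Sum>y\<in>D. of_bool (y \<in> X) :: real) = real (card X)" if "X \<subseteq> D" for X
      using assms(1) that by (simp add: sum_of_bool_eq Int_absorb1 Collect_mem_eq)
    from this[OF assms(2)] this[OF assms(3)] this[of "A \<inter> B"] show ?thesis
      using assms by (simp add: sum.distrib flip: sum_distrib_left) blast
  qed
  also have "\<dots> = (real (card D) - real (card A) - real (card B) + real (card (A \<inter> B))) * g 0
      + (real (card A) + real (card B) - 2 * real (card (A \<inter> B))) * g 1
      + real (card (A \<inter> B)) * g 2"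
    by (simp add: algebra_simps)
  finally show ?thesis .
qed

text \<open>Here \<open>k0\<close>, \<open>k1\<close>, \<open>k2\<close> count the elements of
  \<open>D\<close> in neither, exactly one and both of \<open>A\<close> and \<open>B\<close>.
  Ordered pairs of distinct elements are sorted by total weight; total 2, for instance, arises as 1
  + 1, 0 + 2 or 2 + 0.\<close>

lemma sum_two_subsets_of_bool:
  fixes g :: "nat \<Rightarrow> real"
  assumes "finite D" "A \<subseteq> D" "B \<subseteq> D"
  defines "k1 \<equiv> real (card A) + real (card B) - 2 * real (card (A \<inter> B))"
    and "k2 \<equiv> real (card (A \<inter> B))"
  defines "k0 \<equiv> real (card D) - k1 - k2"
  shows "2 * (\<Sum>R\<in>two_subsets D. g (\<Sum>y\<in>R. of_bool (y \<in> A) + of_bool (y \<in> B)))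
    = k0 * (k0 - 1) * g 0 + 2 * k0 * k1 * g 1 + (k1 * (k1 - 1) + 2 * k0 * k2) * g 2
      + 2 * k1 * k2 * g 3 + k2 * (k2 - 1) * g 4"
proof -
  let ?w = "\<lambda>y. of_bool (y \<in> A) + of_bool (y \<in> B) :: nat"
  \<comment> \<open>Stated for every \<open>h\<close> because it is applied to the inner sum, the
    outer sum and the diagonal, each with a different function.\<close>
  have step: "(\<Sum>y\<in>D. h (?w y)) = k0 * h 0 + k1 * h 1 + k2 * h 2" for h :: "nat \<Rightarrow> real"
    unfolding sum_of_bool_plus_of_bool[OF assms(1-3)] k0_def k1_def k2_def by simp
  have "(\<Sum>y\<in>D. \<Sum>y'\<in>D. g (?w y + ?w y'))
      = (\<Sum>y\<in>D. k0 * g (?w y) + k1 * g (?w y + 1) + k2 * g (?w y + 2))"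
    by (rule sum.cong[OF refl]) (subst step, simp)
  also have "\<dots> = k0 * (k0 * g 0 + k1 * g 1 + k2 * g 2) + k1 * (k0 * g 1 + k1 * g 2 + k2 * g 3)
      + k2 * (k0 * g 2 + k1 * g 3 + k2 * g 4)"
    by (subst step) (simp add: algebra_simps numeral_eq_Suc)
  finally have "(\<Sum>y\<in>D. \<Sum>y'\<in>D. g (?w y + ?w y')) = \<dots>" .
  moreover have "(\<Sum>y\<in>D. g (2 * ?w y)) = k0 * g 0 + k1 * g 2 + k2 * g 4"
    by (subst step) simp
  ultimately show ?thesis
    unfolding sum_two_subsets_additive[OF assms(1)] by (simp add: algebra_simps)
qed

section \<open>Subnetworks indexed by symbol pairs\<close>

definition symbol_pairs :: "nat \<Rightarrow> (nat \<times> nat) set" where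
  "symbol_pairs n = {(a, b). a \<in> {1..n} \<and> b \<in> {1..n} \<and> a \<noteq> b}"

abbreviation middle_of :: "nat \<Rightarrow> nat \<times> nat \<Rightarrow> nat list set" where
  "middle_of n x \<equiv> middle_subnet n (fst x) (snd x)"

abbreviation suffix_of :: "nat \<Rightarrow> nat \<times> nat \<Rightarrow> nat list set" where
  "suffix_of n x \<equiv> suffix_subnet n (fst x) (snd x)"

text \<open>Indices of the suffix forms that share a vertex with the middle form of
  \<open>x\<close>. Working with symbol pairs instead of vertex sets turns the count of overlaps
  into a count of symbols.\<close>

definition meeting_suffixes :: "nat \<Rightarrow> nat \<times> nat \<Rightarrow> (nat \<times> nat) set" where
  "meeting_suffixes n x = {y \<in> symbol_pairs n. snd y = snd x \<and> fst y \<noteq> fst x}"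

lemma symbol_pairs_eq: "symbol_pairs n = (SIGMA a:{1..n}. {1..n} - {a})"
  by (auto simp: symbol_pairs_def)

lemma finite_symbol_pairs: "finite (symbol_pairs n)"
  by (simp add: symbol_pairs_eq)

lemma card_symbol_pairs: "card (symbol_pairs n) = n * (n - 1)"
  unfolding symbol_pairs_eq by (subst card_SigmaI) auto

lemma middle_subnets_eq: "middle_subnets n = middle_of n ` symbol_pairs n"
  by (force simp: middle_subnets_def symbol_pairs_def)

lemma suffix_subnets_eq: "suffix_subnets n = suffix_of n ` symbol_pairs n"
  by (force simp: suffix_subnets_def symbol_pairs_def)

section \<open>Size and disjointness within one form\<close>

lemma card_middle_of:
  assumes "n \<ge> 4" "x \<in> symbol_pairs n"
  shows "card (middle_of n x) = fact (n - 2)"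
  unfolding middle_subnet_def
  by (rule card_vertices_two_entries) (use assms in \<open>auto simp: symbol_pairs_def\<close>)

lemma card_suffix_of:
  assumes "n \<ge> 4" "x \<in> symbol_pairs n"
  shows "card (suffix_of n x) = fact (n - 2)"
  unfolding suffix_subnet_def
  by (rule card_vertices_two_entries) (use assms in \<open>auto simp: symbol_pairs_def\<close>)

lemma finite_vertices: "finite (bubble_sort_vertices n)"
  by (simp add: bubble_sort_vertices_def)

lemma finite_middle_of: "finite (middle_of n x)"
  by (simp add: middle_subnet_def finite_vertices)

lemma finite_suffix_of: "finite (suffix_of n x)"
  by (simp add: suffix_subnet_def finite_vertices)

lemma middle_of_disjoint: "x \<noteq> x' \<Longrightarrow> middle_of n x \<inter> middle_of n x' = {}"
  by (auto simp: middle_subnet_def prod_eq_iff)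

lemma suffix_of_disjoint: "y \<noteq> y' \<Longrightarrow> suffix_of n y \<inter> suffix_of n y' = {}"
  by (auto simp: suffix_subnet_def prod_eq_iff)

text \<open>Distinct pairs give disjoint sets, and disjoint sets coincide only if both are empty,
  which the cardinality \<open>fact (n - 2)\<close> excludes.\<close>

lemma inj_on_middle_of:
  assumes "n \<ge> 4"
  shows "inj_on (middle_of n) (symbol_pairs n)"
proof (rule inj_onI, rule ccontr)
  fix x x' assume "x \<in> symbol_pairs n" "middle_of n x = middle_of n x'" "x \<noteq> x'"
  then show False
    using middle_of_disjoint[of x x' n] card_middle_of[OF assms, of x] by simp
qed

lemma inj_on_suffix_of:
  assumes "n \<ge> 4"
  shows "inj_on (suffix_of n) (symbol_pairs n)"
proof (rule inj_onI, rule ccontr)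
  fix y y' assume "y \<in> symbol_pairs n" "suffix_of n y = suffix_of n y'" "y \<noteq> y'"
  then show False
    using suffix_of_disjoint[of y y' n] card_suffix_of[OF assms, of y] by simp
qed

section \<open>Separation of the three forms\<close>

text \<open>A middle form leaves index \<open>n - 2\<close> free, so it contains a vertex whose
  entry there differs from the one that a given suffix form demands.\<close>

lemma middle_suffix_subnets_disjoint:
  assumes "n \<ge> 4"
  shows "middle_subnets n \<inter> suffix_subnets n = {}"
proof -
  have "middle_subnet n a b \<noteq> suffix_subnet n e f" if "a \<in> {1..n}" "b \<in> {1..n}" "a \<noteq> b" for a b e f
  proof -
    have "\<exists>u\<in>bubble_sort_vertices n. u ! 0 = a \<and> u ! (n - 1) = b \<and> u ! (n - 2) \<noteq> e"
      by (rule ex_vertex_avoiding_entry) (use assms that in auto)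
    then obtain u where "u \<in> bubble_sort_vertices n" "u ! 0 = a" "u ! (n - 1) = b" "u ! (n - 2) \<noteq> e"
      by blast
    then have "u \<in> middle_subnet n a b" "u \<notin> suffix_subnet n e f"
      by (simp_all add: middle_subnet_def suffix_subnet_def)
    then show ?thesis by blast
  qed
  then show ?thesis unfolding middle_subnets_def suffix_subnets_def by fast
qed

text \<open>A prefix form leaves the last position free, while middle and suffix forms both fix it.
  The same kind of witness therefore works in \<open>prefix_suffix_subnets_disjoint\<close>.\<close>

lemma prefix_middle_subnets_disjoint:
  assumes "n \<ge> 4"
  shows "prefix_subnets n \<inter> middle_subnets n = {}"
proof -
  have "prefix_subnet n a b \<noteq> middle_subnet n e f" if "a \<in> {1..n}" "b \<in> {1..n}" "a \<noteq> b" for a b e f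
  proof -
    have "\<exists>u\<in>bubble_sort_vertices n. u ! 0 = a \<and> u ! 1 = b \<and> u ! (n - 1) \<noteq> f"
      by (rule ex_vertex_avoiding_entry) (use assms that in auto)
    then obtain u where "u \<in> bubble_sort_vertices n" "u ! 0 = a" "u ! 1 = b" "u ! (n - 1) \<noteq> f"
      by blast
    then have "u \<in> prefix_subnet n a b" "u \<notin> middle_subnet n e f"
      by (simp_all add: prefix_subnet_def middle_subnet_def)
    then show ?thesis by blast
  qed
  then show ?thesis unfolding prefix_subnets_def middle_subnets_def by fast
qed

lemma prefix_suffix_subnets_disjoint:
  assumes "n \<ge> 4"
  shows "prefix_subnets n \<inter> suffix_subnets n = {}"
proof -
  have "prefix_subnet n a b \<noteq> suffix_subnet n e f" if "a \<in> {1..n}" "b \<in> {1..n}" "a \<noteq> b" for a b e f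
  proof -
    have "\<exists>u\<in>bubble_sort_vertices n. u ! 0 = a \<and> u ! 1 = b \<and> u ! (n - 1) \<noteq> f"
      by (rule ex_vertex_avoiding_entry) (use assms that in auto)
    then obtain u where "u \<in> bubble_sort_vertices n" "u ! 0 = a" "u ! 1 = b" "u ! (n - 1) \<noteq> f"
      by blast
    then have "u \<in> prefix_subnet n a b" "u \<notin> suffix_subnet n e f"
      by (simp_all add: prefix_subnet_def suffix_subnet_def)
    then show ?thesis by blast
  qed
  then show ?thesis unfolding prefix_subnets_def suffix_subnets_def by fast
qed

section \<open>Overlaps between middle and suffix forms\<close>

text \<open>A meeting pair prescribes three distinct symbols at the indices \<open>0\<close>,
  \<open>n - 2\<close> and \<open>n - 1\<close>. The \<open>of_bool\<close> factor lets the overlaps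
  of a family be added up.\<close>

lemma card_middle_Int_suffix:
  assumes "n \<ge> 4" "x \<in> symbol_pairs n" "y \<in> symbol_pairs n"
  shows "card (middle_of n x \<inter> suffix_of n y) = of_bool (y \<in> meeting_suffixes n x) * fact (n - 3)"
proof (cases "y \<in> meeting_suffixes n x")
  case True
  then have "middle_of n x \<inter> suffix_of n y
      = {u \<in> bubble_sort_vertices n. u ! 0 = fst x \<and> u ! (n - 1) = snd x \<and> u ! (n - 2) = fst y}"
    by (auto simp: middle_subnet_def suffix_subnet_def meeting_suffixes_def)
  moreover have "card \<dots> = fact (n - 3)"
    by (rule card_vertices_three_entries)
      (use assms True in \<open>auto simp: symbol_pairs_def meeting_suffixes_def\<close>)
  ultimately show ?thesis using True by simp
next
  case False
  have "middle_of n x \<inter> suffix_of n y = {}"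
  proof (rule ccontr)
    assume "middle_of n x \<inter> suffix_of n y \<noteq> {}"
    then obtain u where u: "u \<in> bubble_sort_vertices n" "u ! 0 = fst x" "u ! (n - 1) = snd x"
        "u ! (n - 2) = fst y" "u ! (n - 1) = snd y"
      by (auto simp: middle_subnet_def suffix_subnet_def)
    have "distinct u" "length u = n"
      using u(1) by (auto simp: bubble_sort_vertices_def permutations_of_set_def dest: distinct_card)
    \<comment> \<open>The indices \<open>0\<close> and \<open>n - 2\<close> differ, so a common
      vertex would satisfy both conditions of \<open>meeting_suffixes\<close>.\<close>
    then have "u ! 0 \<noteq> u ! (n - 2)" using assms(1) by (simp add: nth_eq_iff_index_eq)
    then show False using u False assms(3) by (simp add: meeting_suffixes_def)
  qed
  then show ?thesis using False by simp
qed

lemma card_meeting_suffixes: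
  assumes "x \<in> symbol_pairs n"
  shows "card (meeting_suffixes n x) = n - 2"
proof -
  have "meeting_suffixes n x = (\<lambda>e. (e, snd x)) ` ({1..n} - {fst x, snd x})"
    using assms by (auto simp: meeting_suffixes_def symbol_pairs_def)
  moreover have "card \<dots> = card ({1..n} - {fst x, snd x})"
    by (intro card_image) (auto simp: inj_on_def)
  moreover have "\<dots> = n - 2"
    using assms by (subst card_Diff_subset) (auto simp: symbol_pairs_def)
  ultimately show ?thesis by simp
qed

text \<open>If the last symbols agree, the next-to-last symbol must avoid that symbol and both first
  symbols, which are different because \<open>x \<noteq> x'\<close>.\<close>

lemma card_meeting_suffixes_Int:
  assumes "x \<in> symbol_pairs n" "x' \<in> symbol_pairs n" "x \<noteq> x'"
  shows "card (meeting_suffixes n x \<inter> meeting_suffixes n x') = (if snd x = snd x' then n - 3 else 0)"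
proof (cases "snd x = snd x'")
  case True
  then have "meeting_suffixes n x \<inter> meeting_suffixes n x'
      = (\<lambda>e. (e, snd x)) ` ({1..n} - {fst x, fst x', snd x})"
    using assms by (auto simp: meeting_suffixes_def symbol_pairs_def)
  moreover have "card \<dots> = card ({1..n} - {fst x, fst x', snd x})"
    by (intro card_image) (auto simp: inj_on_def)
  moreover have "\<dots> = n - 3"
    using assms True by (subst card_Diff_subset) (auto simp: symbol_pairs_def prod_eq_iff)
  ultimately show ?thesis using True by simp
next
  case False
  then have "meeting_suffixes n x \<inter> meeting_suffixes n x' = {}"
    by (auto simp: meeting_suffixes_def)
  then show ?thesis using False by simp
qed

text \<open>The other middle forms with the last symbol of \<open>x\<close> have the same index set
  as the suffix forms that meet \<open>x\<close>.\<close>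

lemma card_symbol_pairs_same_snd:
  assumes "x \<in> symbol_pairs n"
  shows "card {x' \<in> symbol_pairs n - {x}. snd x' = snd x} = n - 2"
proof -
  have "{x' \<in> symbol_pairs n - {x}. snd x' = snd x} = meeting_suffixes n x"
    by (auto simp: meeting_suffixes_def prod_eq_iff)
  then show ?thesis using card_meeting_suffixes[OF assms] by simp
qed

section \<open>Families of two middle and two suffix forms\<close>

text \<open>Inclusion-exclusion for just two sets, the union of the middle forms and the union of
  the suffix forms. Forms of one kind are disjoint, so the intersection of these unions is the
  disjoint union of the pairwise overlaps.\<close>

lemma card_Union_family:
  assumes "n \<ge> 4" "Q \<in> two_subsets (symbol_pairs n)" "R \<in> two_subsets (symbol_pairs n)"
  shows "card (\<Union>(middle_of n ` Q \<union> suffix_of n ` R))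
    = 4 * fact (n - 2) - (\<Sum>y\<in>R. \<Sum>x\<in>Q. of_bool (y \<in> meeting_suffixes n x)) * fact (n - 3)"
proof -
  have Q: "finite Q" "card Q = 2" "Q \<subseteq> symbol_pairs n" and R: "finite R" "card R = 2" "R \<subseteq> symbol_pairs n"
    using assms(2,3) by (auto simp: two_subsets_def intro: card_ge_0_finite)
  let ?U = "\<Union>x\<in>Q. middle_of n x" and ?V = "\<Union>y\<in>R. suffix_of n y"
  have "card ?U = (\<Sum>x\<in>Q. card (middle_of n x))"
    using Q by (intro card_UN_disjoint) (auto simp: finite_middle_of middle_of_disjoint)
  also have "\<dots> = (\<Sum>x\<in>Q. fact (n - 2))"
    using Q assms(1) by (intro sum.cong) (auto simp del: fact_Suc intro: card_middle_of)
  finally have U: "card ?U = 2 * fact (n - 2)" using Q by simp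
  have "card ?V = (\<Sum>y\<in>R. card (suffix_of n y))"
    using R by (intro card_UN_disjoint) (auto simp: finite_suffix_of suffix_of_disjoint)
  also have "\<dots> = (\<Sum>y\<in>R. fact (n - 2))"
    using R assms(1) by (intro sum.cong) (auto simp del: fact_Suc intro: card_suffix_of)
  finally have V: "card ?V = 2 * fact (n - 2)" using R by simp
  have "?U \<inter> ?V = (\<Union>y\<in>R. \<Union>x\<in>Q. middle_of n x \<inter> suffix_of n y)" by blast
  also have "card \<dots> = (\<Sum>y\<in>R. card (\<Union>x\<in>Q. middle_of n x \<inter> suffix_of n y))"
  proof (intro card_UN_disjoint)
    show "\<forall>y\<in>R. \<forall>y'\<in>R. y \<noteq> y' \<longrightarrow> (\<Union>x\<in>Q. middle_of n x \<inter> suffix_of n y)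
        \<inter> (\<Union>x\<in>Q. middle_of n x \<inter> suffix_of n y') = {}"
      using suffix_of_disjoint by blast
  qed (use Q R in \<open>auto simp: finite_middle_of\<close>)
  also have "\<dots> = (\<Sum>y\<in>R. \<Sum>x\<in>Q. card (middle_of n x \<inter> suffix_of n y))"
  proof (intro sum.cong[OF refl] card_UN_disjoint)
    fix y
    show "\<forall>x\<in>Q. \<forall>x'\<in>Q. x \<noteq> x' \<longrightarrow> (middle_of n x \<inter> suffix_of n y)
        \<inter> (middle_of n x' \<inter> suffix_of n y) = {}"
      using middle_of_disjoint by blast
  qed (use Q R in \<open>auto simp: finite_middle_of\<close>)
  also have "\<dots> = (\<Sum>y\<in>R. \<Sum>x\<in>Q. of_bool (y \<in> meeting_suffixes n x) * fact (n - 3))"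
    using Q R assms(1) by (intro sum.cong[OF refl] card_middle_Int_suffix) auto
  also have "\<dots> = (\<Sum>y\<in>R. \<Sum>x\<in>Q. of_bool (y \<in> meeting_suffixes n x)) * fact (n - 3)"
    by (simp only: sum_distrib_right)
  finally have UV: "card (?U \<inter> ?V) = \<dots>" .
  \<comment> \<open>This additive form also shows that the subtraction of natural numbers in the
    statement is not truncated.\<close>
  have "card ?U + card ?V = card (?U \<union> ?V) + card (?U \<inter> ?V)"
    using Q R by (intro card_Un_Int) (auto simp: finite_middle_of finite_suffix_of)
  moreover have "\<Union>(middle_of n ` Q \<union> suffix_of n ` R) = ?U \<union> ?V" by blast
  ultimately show ?thesis using U V UV by simp
qed

text \<open>As the forms are separated, intersecting a family with \<open>middle_subnets n\<close>
  or \<open>suffix_subnets n\<close> recovers the two images, and injectivity on symbol pairs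
  recovers \<open>Q\<close> and \<open>R\<close>.\<close>

lemma bij_betw_families:
  assumes "n \<ge> 4"
  shows "bij_betw (\<lambda>(Q, R). middle_of n ` Q \<union> suffix_of n ` R)
    (two_subsets (symbol_pairs n) \<times> two_subsets (symbol_pairs n)) (subnet_families n 0 2 2)"
proof -
  let ?D = "symbol_pairs n"
  let ?F = "\<lambda>(Q, R). middle_of n ` Q \<union> suffix_of n ` R"
  note disj = middle_suffix_subnets_disjoint[OF assms] prefix_middle_subnets_disjoint[OF assms]
    prefix_suffix_subnets_disjoint[OF assms]
  note injM = inj_on_middle_of[OF assms] and injS = inj_on_suffix_of[OF assms]
  have parts: "?F (Q, R) \<inter> middle_subnets n = middle_of n ` Q"
      "?F (Q, R) \<inter> suffix_subnets n = suffix_of n ` R"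
      "?F (Q, R) \<inter> prefix_subnets n = {}"
    if "Q \<subseteq> ?D" "R \<subseteq> ?D" for Q R
  proof -
    have "middle_of n ` Q \<subseteq> middle_subnets n" "suffix_of n ` R \<subseteq> suffix_subnets n"
      using that unfolding middle_subnets_eq suffix_subnets_eq by (simp_all add: image_mono)
    then show "?F (Q, R) \<inter> middle_subnets n = middle_of n ` Q"
        "?F (Q, R) \<inter> suffix_subnets n = suffix_of n ` R"
        "?F (Q, R) \<inter> prefix_subnets n = {}"
      unfolding prod.case using disj by blast+
  qed
  show ?thesis
  proof (rule bij_betw_imageI)
    show "inj_on ?F (two_subsets ?D \<times> two_subsets ?D)"
    proof (rule inj_onI, clarify)
      fix Q R Q' R'
      assume "Q \<in> two_subsets ?D" "R \<in> two_subsets ?D" "Q' \<in> two_subsets ?D" "R' \<in> two_subsets ?D"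
      then have sub: "Q \<subseteq> ?D" "R \<subseteq> ?D" "Q' \<subseteq> ?D" "R' \<subseteq> ?D"
        by (auto simp: two_subsets_def)
      assume "middle_of n ` Q \<union> suffix_of n ` R = middle_of n ` Q' \<union> suffix_of n ` R'"
      then have eq: "?F (Q, R) = ?F (Q', R')" by simp
      have "middle_of n ` Q = middle_of n ` Q'" "suffix_of n ` R = suffix_of n ` R'"
        using arg_cong[OF eq, of "\<lambda>S. S \<inter> middle_subnets n"]
          arg_cong[OF eq, of "\<lambda>S. S \<inter> suffix_subnets n"]
        unfolding parts(1,2)[OF sub(1,2)] parts(1,2)[OF sub(3,4)] by blast+
      then show "Q = Q' \<and> R = R'"
        using inj_on_image_eq_iff[OF injM sub(1,3)] inj_on_image_eq_iff[OF injS sub(2,4)] by blast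
    qed
    show "?F ` (two_subsets ?D \<times> two_subsets ?D) = subnet_families n 0 2 2"
    proof (intro subset_antisym subsetI)
      fix S assume "S \<in> ?F ` (two_subsets ?D \<times> two_subsets ?D)"
      then obtain Q R where S: "S = ?F (Q, R)"
        and sub: "Q \<subseteq> ?D" "R \<subseteq> ?D" and "card Q = 2" "card R = 2"
        by (auto simp: two_subsets_def)
      have cards: "card (middle_of n ` Q) = 2" "card (suffix_of n ` R) = 2"
        using card_image[OF inj_on_subset[OF injM sub(1)]] card_image[OF inj_on_subset[OF injS sub(2)]]
          \<open>card Q = 2\<close> \<open>card R = 2\<close> by simp_all
      have "middle_of n ` Q \<inter> suffix_of n ` R = {}"
        using disj(1) sub unfolding middle_subnets_eq suffix_subnets_eq by blast
      then have "card S = 4"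
        using cards unfolding S by (subst prod.case, subst card_Un_disjoint) (auto intro: card_ge_0_finite)
      moreover have "S \<subseteq> prefix_subnets n \<union> middle_subnets n \<union> suffix_subnets n"
        using sub unfolding S middle_subnets_eq suffix_subnets_eq by auto
      ultimately show "S \<in> subnet_families n 0 2 2"
        using cards parts[OF sub, folded S] by (simp add: subnet_families_def)
    next
      fix S assume S: "S \<in> subnet_families n 0 2 2"
      then have fin: "finite S" and sub: "S \<subseteq> prefix_subnets n \<union> middle_subnets n \<union> suffix_subnets n"
        and cards: "card (S \<inter> prefix_subnets n) = 0" "card (S \<inter> middle_subnets n) = 2"
          "card (S \<inter> suffix_subnets n) = 2"
        by (auto simp: subnet_families_def intro: card_ge_0_finite)
      \<comment> \<open>Cardinality 0 means empty only for finite sets; \<open>S\<close> is finite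
        because \<open>card S = 4\<close>.\<close>
      have "S \<inter> prefix_subnets n = {}" using cards(1) fin by simp
      then have S_eq: "S = (S \<inter> middle_subnets n) \<union> (S \<inter> suffix_subnets n)" using sub by blast
      have "S \<inter> middle_subnets n \<subseteq> middle_of n ` ?D"
        by (simp add: middle_subnets_eq)
      then obtain Q where Q: "Q \<subseteq> ?D" "S \<inter> middle_subnets n = middle_of n ` Q"
        by (rule subset_imageE)
      have "S \<inter> suffix_subnets n \<subseteq> suffix_of n ` ?D"
        by (simp add: suffix_subnets_eq)
      then obtain R where R: "R \<subseteq> ?D" "S \<inter> suffix_subnets n = suffix_of n ` R"
        by (rule subset_imageE)
      have "card Q = 2" "card R = 2"
        using cards(2,3) Q R card_image[OF inj_on_subset[OF injM Q(1)]]
          card_image[OF inj_on_subset[OF injS R(1)]] by simp_all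
      then have "(Q, R) \<in> two_subsets ?D \<times> two_subsets ?D"
        using Q R by (simp add: two_subsets_def)
      moreover have "S = ?F (Q, R)" using S_eq Q R by simp
      ultimately show "S \<in> ?F ` (two_subsets ?D \<times> two_subsets ?D)" by blast
    qed
  qed
qed

section \<open>Evaluation of the sum over families\<close>

text \<open>With \<open>R\<close> as the outer index in the exponent, each \<open>y\<close> in
  \<open>R\<close> carries as weight the number of members of \<open>Q\<close> that it meets. For
  fixed \<open>Q\<close> this is the shape required by
  \<open>sum_two_subsets_of_bool\<close>.\<close>

lemma P_four_eq_sum_two_subsets:
  assumes "n \<ge> 4" "0 \<le> p" "p \<le> 1"
  shows "P_four n p 0 2 2 = (\<Sum>Q\<in>two_subsets (symbol_pairs n). \<Sum>R\<in>two_subsets (symbol_pairs n).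
    p ^ (4 * fact (n - 2) - (\<Sum>y\<in>R. \<Sum>x\<in>Q. of_bool (y \<in> meeting_suffixes n x)) * fact (n - 3)))"
proof -
  have "P_four n p 0 2 2 = (\<Sum>S\<in>subnet_families n 0 2 2. p ^ card (\<Union>S))"
    unfolding P_four_def by (intro sum.cong refl prob_fault_free assms(2,3))
  also have "\<dots> = (\<Sum>(Q, R)\<in>two_subsets (symbol_pairs n) \<times> two_subsets (symbol_pairs n).
      p ^ card (\<Union>(middle_of n ` Q \<union> suffix_of n ` R)))"
    by (subst sum.reindex_bij_betw[OF bij_betw_families[OF assms(1)], symmetric])
      (simp add: case_prod_unfold)
  also have "\<dots> = (\<Sum>Q\<in>two_subsets (symbol_pairs n). \<Sum>R\<in>two_subsets (symbol_pairs n).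
      p ^ card (\<Union>(middle_of n ` Q \<union> suffix_of n ` R)))"
    by (simp only: sum.cartesian_product)
  also have "\<dots> = (\<Sum>Q\<in>two_subsets (symbol_pairs n). \<Sum>R\<in>two_subsets (symbol_pairs n).
    p ^ (4 * fact (n - 2) - (\<Sum>y\<in>R. \<Sum>x\<in>Q. of_bool (y \<in> meeting_suffixes n x)) * fact (n - 3)))"
    by (intro sum.cong refl) (simp only: card_Union_family[OF assms(1)])
  finally show ?thesis .
qed

text \<open>
  The pairs of middle forms and of suffix forms are counted as ordered pairs, whence the factor 4.
  For a given middle form, \<open>(N - 1)\<^sup>2\<close> others have a different last symbol and \<open>N - 2\<close> the same.
\<close>

lemma sum_meeting_suffixes:
  fixes g :: "nat \<Rightarrow> real" and n :: nat
  assumes "n \<ge> 4"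
  defines "N \<equiv> real n"
  shows "4 * (\<Sum>Q\<in>two_subsets (symbol_pairs n). \<Sum>R\<in>two_subsets (symbol_pairs n).
      g (\<Sum>y\<in>R. \<Sum>x\<in>Q. of_bool (y \<in> meeting_suffixes n x)))
    = N * (N - 1) * ((N - 1)^2 * ((N^2 - 3 * N + 4) * (N^2 - 3 * N + 3) * g 0
          + 4 * (N^2 - 3 * N + 4) * (N - 2) * g 1 + 2 * (N - 2) * (2 * N - 5) * g 2)
        + (N - 2) * ((N - 1)^2 * ((N - 1)^2 - 1) * g 0 + 4 * (N - 1)^2 * g 1
          + (2 + 2 * (N - 1)^2 * (N - 3)) * g 2 + 4 * (N - 3) * g 3 + (N - 3) * (N - 4) * g 4))"
    (is "4 * (\<Sum>Q\<in>_. ?G Q) = N * (N - 1) * ((N - 1)^2 * ?c1 + (N - 2) * ?c2)")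
proof -
  let ?D = "symbol_pairs n"
  have Dc: "real (card ?D) = N * (N - 1)"
    using assms(1) by (simp add: card_symbol_pairs N_def of_nat_diff)
  \<comment> \<open>In \<open>sum_two_subsets_of_bool\<close>, equal last symbols give
    \<open>k2 = N - 3\<close>, \<open>k1 = 2\<close>, \<open>k0 = (N - 1)^2\<close>, whence
    \<open>?c2\<close>; different ones give \<open>k2 = 0\<close>, \<open>k1 = 2 * (N - 2)\<close>,
    \<open>k0 = N^2 - 3 * N + 4\<close>, whence \<open>?c1\<close>.\<close>
  have inner: "2 * ?G {x, x'} = (if snd x' = snd x then ?c2 else ?c1)"
    if "x \<in> ?D" "x' \<in> ?D - {x}" for x x'
  proof -
    have "?G {x, x'} = (\<Sum>R\<in>two_subsets ?D. g (\<Sum>y\<in>R.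
        of_bool (y \<in> meeting_suffixes n x) + of_bool (y \<in> meeting_suffixes n x')))"
      using that by (intro sum.cong refl arg_cong[where f = g]) auto
    moreover have "meeting_suffixes n x \<subseteq> ?D" "meeting_suffixes n x' \<subseteq> ?D"
      by (auto simp: meeting_suffixes_def)
    note sum_two_subsets_of_bool[OF finite_symbol_pairs this, of g]
    moreover have "card (meeting_suffixes n x) = n - 2" "card (meeting_suffixes n x') = n - 2"
      using that by (auto intro: card_meeting_suffixes)
    moreover have "card (meeting_suffixes n x \<inter> meeting_suffixes n x')
        = (if snd x' = snd x then n - 3 else 0)"
      using that card_meeting_suffixes_Int[of x n x'] by auto
    moreover have "real (n - 2) = N - 2" "real (n - 3) = N - 3"
      using assms(1) by (simp_all add: N_def of_nat_diff)
    ultimately show ?thesis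
      by (simp add: Dc) (simp add: algebra_simps power2_eq_square)
  qed
  have outer: "(\<Sum>x'\<in>?D - {x}. 2 * ?G {x, x'}) = (N - 1)^2 * ?c1 + (N - 2) * ?c2" if x: "x \<in> ?D" for x
  proof -
    have same: "card {x' \<in> ?D - {x}. snd x' = snd x} = n - 2"
      by (rule card_symbol_pairs_same_snd[OF x])
    have "card {x' \<in> ?D - {x}. snd x' \<noteq> snd x}
        = card ((?D - {x}) - {x' \<in> ?D - {x}. snd x' = snd x})"
      by (rule arg_cong[where f = card]) blast
    also have "\<dots> = card (?D - {x}) - (n - 2)"
      unfolding same[symmetric]
      by (rule card_Diff_subset) (auto intro: finite_subset[OF _ finite_symbol_pairs])
    also have "\<dots> = n * (n - 1) - 1 - (n - 2)"
      using x by (simp add: finite_symbol_pairs card_symbol_pairs)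
    also have "\<dots> = (n - 1)^2"
      using assms(1) by (cases n) (auto simp: power2_eq_square)
    finally have diff: "card {x' \<in> ?D - {x}. snd x' \<noteq> snd x} = (n - 1)^2" .
    have "(\<Sum>x'\<in>?D - {x}. 2 * ?G {x, x'}) = (\<Sum>x'\<in>?D - {x}. if snd x' = snd x then ?c2 else ?c1)"
      using inner[OF x] by (intro sum.cong refl) blast
    also have "\<dots> = (\<Sum>x'\<in>{x' \<in> ?D - {x}. snd x' = snd x}. ?c2)
        + (\<Sum>x'\<in>{x' \<in> ?D - {x}. snd x' \<noteq> snd x}. ?c1)"
      by (subst sum.If_cases) (auto simp: finite_symbol_pairs Int_def)
    also have "\<dots> = real (n - 2) * ?c2 + real ((n - 1)^2) * ?c1"
      by (simp only: sum_constant same diff)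
    also have "\<dots> = (N - 1)^2 * ?c1 + (N - 2) * ?c2"
      using assms(1) by (simp add: N_def of_nat_diff)
    finally show ?thesis .
  qed
  \<comment> \<open>One factor 2 orders the two middle forms; the other orders the two suffix forms
    and is absorbed by \<open>inner\<close>.\<close>
  have "4 * (\<Sum>Q\<in>two_subsets ?D. ?G Q) = 2 * (\<Sum>x\<in>?D. \<Sum>x'\<in>?D - {x}. ?G {x, x'})"
    using sum_two_subsets[OF finite_symbol_pairs[of n], of ?G] by linarith
  also have "\<dots> = (\<Sum>x\<in>?D. \<Sum>x'\<in>?D - {x}. 2 * ?G {x, x'})"
    by (simp only: sum_distrib_left)
  also have "\<dots> = (\<Sum>x\<in>?D. (N - 1)^2 * ?c1 + (N - 2) * ?c2)"
    by (intro sum.cong refl outer)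
  also have "\<dots> = N * (N - 1) * ((N - 1)^2 * ?c1 + (N - 2) * ?c2)"
    by (simp only: sum_constant Dc)
  finally show ?thesis .
qed

theorem theorem7:
  fixes n :: nat and p :: real
  assumes "n \<ge> 4" and "0 \<le> p" and "p \<le> 1"
  shows "P_four n p 0 2 2 =
      1/4 * (real n^8 - 8 * real n^7 + 30 * real n^6 - 69 * real n^5 + 104 * real n^4
              - 99 * real n^3 + 53 * real n^2 - 12 * real n)
        * p ^ (4 * fact (n - 2))
    + (real n^7 - 8 * real n^6 + 29 * real n^5 - 59 * real n^4 + 68 * real n^3
              - 41 * real n^2 + 10 * real n)
        * p ^ (4 * fact (n - 2) - fact (n - 3))
    + 1/2 * (3 * real n^6 - 23 * real n^5 + 67 * real n^4 - 92 * real n^3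
              + 59 * real n^2 - 14 * real n)
        * p ^ (4 * fact (n - 2) - 2 * fact (n - 3))
    + (real n^4 - 6 * real n^3 + 11 * real n^2 - 6 * real n)
        * p ^ (4 * fact (n - 2) - 3 * fact (n - 3))
    + 1/4 * (real n^5 - 10 * real n^4 + 35 * real n^3 - 50 * real n^2 + 24 * real n)
        * p ^ (4 * fact (n - 2) - 4 * fact (n - 3))"
proof -
  \<comment> \<open>Two middle and two suffix forms have at most four meeting pairs, so only
    \<open>g 0\<close> to \<open>g 4\<close> occur.\<close>
  define g where "g m = p ^ (4 * fact (n - 2) - m * fact (n - 3))" for m :: nat
  define N where "N = real n"
  have g: "p ^ (4 * fact (n - 2)) = g 0" "p ^ (4 * fact (n - 2) - fact (n - 3)) = g 1"
    "p ^ (4 * fact (n - 2) - 2 * fact (n - 3)) = g 2"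
    "p ^ (4 * fact (n - 2) - 3 * fact (n - 3)) = g 3"
    "p ^ (4 * fact (n - 2) - 4 * fact (n - 3)) = g 4"
    by (simp_all add: g_def)
  have "4 * P_four n p 0 2 2
    = N * (N - 1) * ((N - 1)^2 * ((N^2 - 3 * N + 4) * (N^2 - 3 * N + 3) * g 0
          + 4 * (N^2 - 3 * N + 4) * (N - 2) * g 1 + 2 * (N - 2) * (2 * N - 5) * g 2)
        + (N - 2) * ((N - 1)^2 * ((N - 1)^2 - 1) * g 0 + 4 * (N - 1)^2 * g 1
          + (2 + 2 * (N - 1)^2 * (N - 3)) * g 2 + 4 * (N - 3) * g 3 + (N - 3) * (N - 4) * g 4))"
    unfolding P_four_eq_sum_two_subsets[OF assms] N_def
    using sum_meeting_suffixes[OF assms(1), of g] by (simp only: g_def)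
  \<comment> \<open>Both sides are linear in \<open>g 0\<close> to \<open>g 4\<close>, and their
    coefficients agree as polynomials in \<open>N\<close>.\<close>
  then show ?thesis
    unfolding g N_def[symmetric] by algebra
qed

end
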